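(* Consider the Random Actions (RA) model with $N$ agents, parameter $\alpha\in(0,1)$ and a row-stochastic trust matrix $W$ (not necessarily irreducible). (i) If, almost surely, all maximal elements in the poset of strongly connected (irreducible) components of the network converge to the same value (i.e. almost surely all opinions $x_{t,i}$ of agents $i$ belonging to maximal elements converge to one common limit in $\{0,1\}$), then the RA model converges to consensus in $r$th moment for every $r>0$: there is a random vector $\mathbf{x}_\infty$ with values in $\{\mathbf{0},\mathbf{1}\}$ (the all-zeros and all-ones vectors in $\mathbb{R}^N$) such that $\mathbf{x}_t\xrightarrow{L^r}\mathbf{x}_\infty$, i.e. $\mathbb{E}\{\|\mathbf{x}_t-\mathbf{x}_\infty\|^r\}\to0$ as $t\to\infty$, for every $r>0$. (ii) The RA model converges to consensus in $r$th moment (in the same sense) for every $r>0$ in the presence of a stubborn agent, that is, whenever the poset of strongly connected components has exactly one maximal element, this maximal element consists of a single agent $k$, and $x_{1,k}\in\{0,1\}$.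
   Context: $\mathbb{N}=\{1,2,\dots\}$; $\|\cdot\|$ is the Euclidean norm on $\mathbb{R}^N$. Random Actions (RA) model: there are $N$ agents, a constant $\alpha\in(0,1)$, and an $N\times N$ row-stochastic matrix $W=(w_{ij})$ (nonnegative entries, each row sums to $1$); $w_{ij}>0$ is regarded as a directed edge from $j$ to $i$. The initial opinion vector $\mathbf{x}_1$ is a random vector in $[0,1]^N$ with arbitrary distribution (subject to any hypotheses in the claim). For each $t\in\mathbb{N}$, conditionally on the history $(\mathbf{x}_1,\mathbf{a}_1,\dots,\mathbf{a}_{t-1})$ (which determines $\mathbf{x}_t$), the actions $a_{t,1},\dots,a_{t,N}\in\{0,1\}$ are independent with $a_{t,i}\sim\mathrm{Bernoulli}(x_{t,i})$, and opinions are updated by $\mathbf{x}_{t+1}=(1-\alpha)\mathbf{x}_t+\alpha W\mathbf{a}_t$. Thus $\mathbf{x}_t\in[0,1]^N$ for all $t$. Components: two agents $i,j$ communicate if there is a directed path (possibly of length $0$) from $i$ to $j$ and one from $j$ to $i$. This is an equivalence relation; its classes $C_1,\dots,C_M$ are the strongly connected components. Write $C_r\preceq C_s$ if there is a directed path (possibly of length $0$) from an agent in $C_s$ to an agent in $C_r$. This is a partial order on $\{C_1,\dots,C_M\}$. A component $C_s$ is a maximal element if there is no $C_t\neq C_s$ with $C_s\preceq C_t$. *)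

theory Defs
  imports "HOL-Probability.Probability"
begin

definition row_stochastic :: "real ^ 'n ^ 'n \<Rightarrow> bool" where
  "row_stochastic W \<longleftrightarrow>
     (\<forall>i j. 0 \<le> W $ i $ j) \<and> (\<forall>i. (\<Sum>j\<in>UNIV. W $ i $ j) = 1)"

(* A pair (j, i) is an edge from j to i: agent i puts positive weight on agent j. *)
definition trust_edges :: "real ^ 'n ^ 'n \<Rightarrow> ('n \<times> 'n) set" where
  "trust_edges W = {(j, i). W $ i $ j > 0}"

definition communicate :: "real ^ 'n ^ 'n \<Rightarrow> ('n \<times> 'n) set" where
  "communicate W =
     {(i, j). (i, j) \<in> (trust_edges W)\<^sup>* \<and> (j, i) \<in> (trust_edges W)\<^sup>*}"

definition components :: "real ^ 'n ^ 'n \<Rightarrow> 'n set set" where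
  "components W = UNIV // communicate W"

(* The larger component influences the smaller one: paths lead from D to C. *)
definition component_le :: "real ^ 'n ^ 'n \<Rightarrow> 'n set \<Rightarrow> 'n set \<Rightarrow> bool" where
  "component_le W C D \<longleftrightarrow> (\<exists>j\<in>D. \<exists>i\<in>C. (j, i) \<in> (trust_edges W)\<^sup>*)"

definition maximal_components :: "real ^ 'n ^ 'n \<Rightarrow> 'n set set" where
  "maximal_components W =
     {C \<in> components W. \<not> (\<exists>D\<in>components W. D \<noteq> C \<and> component_le W C D)}"

(* Time starts at 1, so the values x 0 and a 0 play no role anywhere below.
   The sigma-algebra is the one generated by x 1, a 1, ..., a (t - 1). *)
definition history ::
  "'w measure \<Rightarrow> (nat \<Rightarrow> 'w \<Rightarrow> real ^ 'n) \<Rightarrow> (nat \<Rightarrow> 'w \<Rightarrow> real ^ 'n) \<Rightarrow> nat \<Rightarrow> 'w measure" where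
  "history M x a t =
     vimage_algebra (space M) (\<lambda>\<omega>. (x 1 \<omega>, \<lambda>s\<in>{1..<t}. a s \<omega>))
       (borel \<Otimes>\<^sub>M (\<Pi>\<^sub>M s\<in>{1..<t}. borel))"

definition cond_prob_given :: "'w measure \<Rightarrow> 'w measure \<Rightarrow> 'w set \<Rightarrow> 'w \<Rightarrow> real" where
  "cond_prob_given M F A = real_cond_exp M F (indicator A)"

locale random_actions = prob_space M
  for M :: "'w measure" +
  fixes \<alpha> :: real
    and W :: "real ^ 'n ^ 'n"
    and x :: "nat \<Rightarrow> 'w \<Rightarrow> real ^ 'n"
    and a :: "nat \<Rightarrow> 'w \<Rightarrow> real ^ 'n"
  assumes alpha: "0 < \<alpha>" "\<alpha> < 1"
    and stochastic: "row_stochastic W"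
    and initial_measurable: "x 1 \<in> borel_measurable M"
    and initial_range: "\<And>\<omega> i. \<omega> \<in> space M \<Longrightarrow> x 1 \<omega> $ i \<in> {0..1}"
    and action_measurable: "\<And>t. t \<ge> 1 \<Longrightarrow> a t \<in> borel_measurable M"
    and action_range: "\<And>t \<omega> i. t \<ge> 1 \<Longrightarrow> \<omega> \<in> space M \<Longrightarrow> a t \<omega> $ i \<in> {0, 1}"
    and action_bernoulli:
      "\<And>t i. t \<ge> 1 \<Longrightarrow>
         AE \<omega> in M. cond_prob_given M (history M x a t) {\<omega>' \<in> space M. a t \<omega>' $ i = 1} \<omega>
           = x t \<omega> $ i"
    and action_cond_indep:
      "\<And>t B. t \<ge> 1 \<Longrightarrow> (\<And>i. B i \<in> sets borel) \<Longrightarrow>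
         AE \<omega> in M.
           cond_prob_given M (history M x a t) {\<omega>' \<in> space M. \<forall>i. a t \<omega>' $ i \<in> B i} \<omega>
             = (\<Prod>i\<in>UNIV.
                 cond_prob_given M (history M x a t) {\<omega>' \<in> space M. a t \<omega>' $ i \<in> B i} \<omega>)"
    and update:
      "\<And>t \<omega>. t \<ge> 1 \<Longrightarrow> \<omega> \<in> space M \<Longrightarrow>
         x (t + 1) \<omega> = (1 - \<alpha>) *\<^sub>R x t \<omega> + \<alpha> *\<^sub>R (W *v a t \<omega>)"

(* Integrability is required explicitly because the Bochner integral of a
   non-integrable function is 0. *)
definition converges_in_moment ::
  "'w measure \<Rightarrow> (nat \<Rightarrow> 'w \<Rightarrow> real ^ 'n) \<Rightarrow> ('w \<Rightarrow> real ^ 'n) \<Rightarrow> real \<Rightarrow> bool" where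
  "converges_in_moment M x y r \<longleftrightarrow>
     (\<forall>t\<ge>1. integrable M (\<lambda>\<omega>. norm (x t \<omega> - y \<omega>) powr r)) \<and>
     (\<lambda>t. \<integral>\<omega>. norm (x t \<omega> - y \<omega>) powr r \<partial>M) \<longlonglongrightarrow> 0"

definition consensus_in_all_moments ::
  "'w measure \<Rightarrow> (nat \<Rightarrow> 'w \<Rightarrow> real ^ 'n) \<Rightarrow> bool" where
  "consensus_in_all_moments M x \<longleftrightarrow>
     (\<exists>y\<in>borel_measurable M.
        (\<forall>\<omega>\<in>space M. y \<omega> \<in> {vec 0, vec 1}) \<and>
        (\<forall>r>0. converges_in_moment M x y r))"

end

theory Submission
  imports Defs
begin

text \<open>Let \<open>c\<close> be the common limit of the maximal components and \<open>d i t\<close> the mean distance of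
  \<open>x t $ i\<close> from \<open>c\<close>. Up to an error \<open>2 * d k t\<close>, which vanishes for \<open>k\<close> in a maximal component,
  one step of the dynamics averages \<open>d\<close> with the weights of \<open>(1 - \<alpha>) I + \<alpha> W\<close>. Hence the upper
  limits of \<open>d i\<close> are dominated by their own \<open>W\<close>-averages, and as they vanish on maximal
  components, from which every agent is reachable, they vanish everywhere. Boundedness upgrades
  mean convergence to all moments. For a stubborn agent \<open>k\<close> the weights force \<open>W $ k $ k = 1\<close>, so
  its opinion never leaves the initial value.\<close>

section \<open>An elementary bound for powers\<close>

text \<open>Up to the threshold \<open>\<delta>\<close>, where the power reaches
  \<open>\<epsilon>\<close>, the constant term is enough; beyond it \<open>u / \<delta>\<close>
  exceeds 1 and the linear term dominates \<open>K powr r\<close>. The affine form serves all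
  exponents alike, including \<open>r < 1\<close>, where \<open>u powr r\<close> is not bounded by a
  multiple of \<open>u\<close> near 0.\<close>

lemma powr_le_affine:
  fixes r \<epsilon> K :: real
  assumes "r > 0" "\<epsilon> > 0"
  obtains C where "C \<ge> 0" "\<And>u. 0 \<le> u \<Longrightarrow> u \<le> K \<Longrightarrow> u powr r \<le> \<epsilon> + C * u"
proof
  define \<delta> where "\<delta> = \<epsilon> powr (1 / r)"
  have \<delta>: "\<delta> > 0" "\<delta> powr r = \<epsilon>"
    using assms by (simp_all add: \<delta>_def powr_powr)
  show "K powr r / \<delta> \<ge> 0" using \<delta> by simp
  show "u powr r \<le> \<epsilon> + K powr r / \<delta> * u" if u: "0 \<le> u" "u \<le> K" for u
  proof (cases "u \<le> \<delta>")
    case True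
    then have "u powr r \<le> \<delta> powr r"
      using u assms by (intro powr_mono2) auto
    then show ?thesis using \<delta> u by (simp add: add_increasing2)
  next
    case False
    have "u powr r \<le> K powr r"
      using u assms by (intro powr_mono2) auto
    also have "\<dots> = K powr r / \<delta> * \<delta>" using \<delta> by simp
    also have "\<dots> \<le> K powr r / \<delta> * u"
      using False \<delta> by (intro mult_left_mono) auto
    finally show ?thesis using assms by linarith
  qed
qed

section \<open>The poset of strongly connected components\<close>

lemma components_Image: "C \<in> components W \<longleftrightarrow> (\<exists>k. C = communicate W `` {k})"
  by (auto simp: components_def quotient_def)

text \<open>The witness \<open>k\<close> is an ancestor of \<open>i\<close> with the fewest ancestors.\<close>

lemma maximal_ancestor:
  fixes W :: "real ^ 'n::finite ^ 'n"
  obtains C k where "C \<in> maximal_components W" "k \<in> C" "(k, i) \<in> (trust_edges W)\<^sup>*"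
proof -
  define anc where "anc k = {j. (j, k) \<in> (trust_edges W)\<^sup>*}" for k
  define k where "k = arg_min (\<lambda>k. card (anc k)) (\<lambda>k. k \<in> anc i)"
  have "i \<in> anc i" by (simp add: anc_def)
  then have k: "k \<in> anc i" "\<And>j. j \<in> anc i \<Longrightarrow> card (anc k) \<le> card (anc j)"
    using arg_min_nat_lemma[of "\<lambda>k. k \<in> anc i" i "\<lambda>k. card (anc k)"]
    by (auto simp: k_def)
  \<comment> \<open>Passing from \<open>k\<close> to an ancestor \<open>j\<close> can only shrink
    the set of ancestors, and minimality forbids a strict loss. So every ancestor of
    \<open>k\<close> is also a descendant of \<open>k\<close>.\<close>
  have desc: "(k, j) \<in> (trust_edges W)\<^sup>*" if j: "(j, k) \<in> (trust_edges W)\<^sup>*" for j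
  proof -
    have sub: "anc j \<subseteq> anc k" using j by (auto simp: anc_def)
    have "j \<in> anc i" using j k(1) by (auto simp: anc_def)
    then have "anc j = anc k"
      using sub k(2) by (intro card_seteq) auto
    then show ?thesis by (auto simp: anc_def)
  qed
  define C where "C = communicate W `` {k}"
  \<comment> \<open>A component above \<open>C\<close> contains an ancestor of \<open>k\<close>,
    which by \<open>desc\<close> communicates with \<open>k\<close>.\<close>
  have "D = C" if D: "D \<in> components W" "component_le W C D" for D
  proof -
    obtain l where l: "D = communicate W `` {l}" using D(1) components_Image by blast
    obtain j i' where j: "j \<in> D" "i' \<in> C" "(j, i') \<in> (trust_edges W)\<^sup>*"
      using D(2) by (auto simp: component_le_def)
    then have "(j, k) \<in> (trust_edges W)\<^sup>*"
      by (auto simp: C_def communicate_def)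
    then have "(j, k) \<in> (trust_edges W)\<^sup>*" "(k, j) \<in> (trust_edges W)\<^sup>*"
      using desc by auto
    then have "(l, k) \<in> (trust_edges W)\<^sup>*" "(k, l) \<in> (trust_edges W)\<^sup>*"
      using j(1) by (auto simp: l communicate_def intro: rtrancl_trans)
    then show "D = C"
      unfolding l C_def communicate_def by (auto intro: rtrancl_trans)
  qed
  moreover have "C \<in> components W" by (auto simp: components_Image C_def)
  ultimately have "C \<in> maximal_components W"
    unfolding maximal_components_def by blast
  moreover have "k \<in> C" by (auto simp: C_def communicate_def)
  ultimately show ?thesis using that k(1) by (auto simp: anc_def)
qed

text \<open>An agent \<open>l\<close> trusted by \<open>k\<close> is an ancestor of
  \<open>k\<close>. It also descends from \<open>k\<close>, because every agent has an ancestor in a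
  maximal component and \<open>{k}\<close> is the only one. Hence \<open>l\<close> lies in the class
  of \<open>k\<close>, which is a singleton, and the whole row sum sits on the diagonal.\<close>

lemma singleton_maximal_component_weight:
  fixes W :: "real ^ 'n::finite ^ 'n"
  assumes "row_stochastic W" "maximal_components W = {{k}}"
  shows "W $ k $ j = (if j = k then 1 else 0)"
proof -
  have only: "l = k" if "W $ k $ l > 0" for l
  proof -
    have lk: "(l, k) \<in> (trust_edges W)\<^sup>*"
      using that by (auto simp: trust_edges_def)
    have "(k, l) \<in> (trust_edges W)\<^sup>*"
      by (rule maximal_ancestor[of W l]) (use assms(2) in auto)
    with lk have kl: "(k, l) \<in> communicate W" by (auto simp: communicate_def)
    have "{k} \<in> components W" using assms(2) by (auto simp: maximal_components_def)
    then obtain m where "{k} = communicate W `` {m}" by (auto simp: components_Image)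
    then have mk: "(m, k) \<in> communicate W" and m: "\<And>n. (m, n) \<in> communicate W \<Longrightarrow> n = k"
      by auto
    from mk kl have "(m, l) \<in> communicate W"
      unfolding communicate_def by (auto intro: rtrancl_trans)
    then show ?thesis by (rule m)
  qed
  have nonneg: "0 \<le> W $ k $ l" for l using assms(1) by (simp add: row_stochastic_def)
  then have zero: "W $ k $ l = 0" if "l \<noteq> k" for l
    using only[of l] nonneg[of l] that by fastforce
  have "1 = (\<Sum>l\<in>UNIV. W $ k $ l)" using assms(1) by (simp add: row_stochastic_def)
  also have "\<dots> = W $ k $ k + (\<Sum>l\<in>UNIV - {k}. W $ k $ l)" by (simp add: sum.remove)
  also have "(\<Sum>l\<in>UNIV - {k}. W $ k $ l) = 0" by (intro sum.neutral) (auto simp: zero)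
  finally show ?thesis using zero by auto
qed

section \<open>Maximum principle for upper limits\<close>

text \<open>The upper limits of \<open>d i\<close> form a subharmonic vector, so they obey a maximum principle:
  a node attaining the maximum passes it on to all its ancestors.\<close>

lemma tendsto_zero_of_ancestors:
  fixes W :: "real ^ 'n::finite ^ 'n" and d :: "'n \<Rightarrow> nat \<Rightarrow> real"
  assumes W: "row_stochastic W" and \<alpha>: "0 < \<alpha>" "\<alpha> < 1"
    and d: "\<forall>\<^sub>F t in sequentially. \<forall>i. 0 \<le> d i t \<and> d i t \<le> 1"
    and e: "e \<longlonglongrightarrow> 0"
    and step: "\<forall>\<^sub>F t in sequentially. \<forall>i.
        d i (Suc t) \<le> (1 - \<alpha>) * d i t + \<alpha> * (\<Sum>j\<in>UNIV. W $ i $ j * d j t) + e t"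
    and anc: "\<And>i. \<exists>k. (k, i) \<in> (trust_edges W)\<^sup>* \<and> d k \<longlonglongrightarrow> 0"
  shows "d i \<longlonglongrightarrow> 0"
proof -
  \<comment> \<open>\<open>B i\<close> collects the eventual upper bounds of \<open>d i\<close>, so
    \<open>h i\<close> is the upper limit of \<open>d i\<close>, kept as a real number. The bounds 0
    and 1 on \<open>d\<close> ensure that the infimum is taken over a nonempty set bounded
    below.\<close>
  define B where "B i = {b. \<forall>\<^sub>F t in sequentially. d i t \<le> b}" for i
  define h where "h i = Inf (B i)" for i
  have nonneg: "0 \<le> W $ i $ j" and row: "(\<Sum>j\<in>UNIV. W $ i $ j) = 1" for i j
    using W by (auto simp: row_stochastic_def)
  have low: "0 \<le> b" if "b \<in> B i" for b i
  proof -
    have "\<forall>\<^sub>F t in sequentially. 0 \<le> b"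
      using that[unfolded B_def, simplified] d by eventually_elim (meson order_trans)
    then show ?thesis by simp
  qed
  have one: "1 \<in> B i" for i
    using d by (auto simp: B_def elim: eventually_mono)
  have hle: "h i \<le> b" if "\<forall>\<^sub>F t in sequentially. d i t \<le> b" for i b
    unfolding h_def
  proof (rule cInf_lower)
    show "b \<in> B i" using that by (simp add: B_def)
    show "bdd_below (B i)" using low by (rule bdd_belowI)
  qed
  have ev: "\<forall>\<^sub>F t in sequentially. d i t \<le> h i + \<epsilon>" if "\<epsilon> > 0" for i \<epsilon>
  proof -
    have "B i \<noteq> {}" "Inf (B i) < h i + \<epsilon>" using one[of i] that by (auto simp: h_def)
    from cInf_lessD[OF this] obtain b where b: "b \<in> B i" "b < h i + \<epsilon>" by blast
    then have "\<forall>\<^sub>F t in sequentially. d i t \<le> b" by (simp add: B_def)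
    then show ?thesis by eventually_elim (use b in linarith)
  qed
  have sub: "h i \<le> (\<Sum>j\<in>UNIV. W $ i $ j * h j)" (is "_ \<le> ?S") for i
  proof -
    have "h i \<le> (1 - \<alpha>) * h i + \<alpha> * ?S + \<epsilon>" if "\<epsilon> > 0" for \<epsilon>
    proof -
      \<comment> \<open>One \<open>\<eta>\<close> is lost in replacing \<open>d\<close> by
        \<open>h\<close>, since the weights \<open>1 - \<alpha>\<close> and \<open>\<alpha>\<close>
        times a row of \<open>W\<close> add up to 1; the other \<open>\<eta>\<close> absorbs
        \<open>e t\<close>.\<close>
      define \<eta> where "\<eta> = \<epsilon> / 2"
      have \<eta>: "\<eta> > 0" using that by (simp add: \<eta>_def)
      have "\<forall>\<^sub>F t in sequentially. \<forall>j. d j t \<le> h j + \<eta>"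
        using ev[OF \<eta>] by (simp add: eventually_all_finite)
      moreover have "\<forall>\<^sub>F t in sequentially. e t < \<eta>"
        using e \<eta> by (rule order_tendstoD)
      ultimately have "\<forall>\<^sub>F t in sequentially. d i (Suc t) \<le> (1 - \<alpha>) * h i + \<alpha> * ?S + \<epsilon>"
        using step
      proof eventually_elim
        case (elim t)
        have "(\<Sum>j\<in>UNIV. W $ i $ j * d j t) \<le> (\<Sum>j\<in>UNIV. W $ i $ j * (h j + \<eta>))"
          using elim nonneg by (intro sum_mono mult_left_mono) auto
        also have "\<dots> = ?S + \<eta>"
          using row[of i] by (simp add: distrib_left sum.distrib sum_distrib_right[symmetric])
        finally have "\<alpha> * (\<Sum>j\<in>UNIV. W $ i $ j * d j t) \<le> \<alpha> * (?S + \<eta>)"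
          using \<alpha> by (intro mult_left_mono) auto
        moreover have "(1 - \<alpha>) * d i t \<le> (1 - \<alpha>) * (h i + \<eta>)"
          using \<alpha> elim by (intro mult_left_mono) auto
        moreover have "d i (Suc t) \<le> (1 - \<alpha>) * d i t + \<alpha> * (\<Sum>j\<in>UNIV. W $ i $ j * d j t) + e t"
          using elim by blast
        moreover have "(1 - \<alpha>) * (h i + \<eta>) + \<alpha> * (?S + \<eta>) + \<eta> = (1 - \<alpha>) * h i + \<alpha> * ?S + \<epsilon>"
          by (simp add: \<eta>_def field_simps)
        ultimately show ?case using elim(2) by linarith
      qed
      then show ?thesis
        using hle eventually_sequentially_Suc[of "\<lambda>t. d i t \<le> (1 - \<alpha>) * h i + \<alpha> * ?S + \<epsilon>"]
        by blast
    qed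
    then have "h i \<le> (1 - \<alpha>) * h i + \<alpha> * ?S" by (rule field_le_epsilon)
    then have "\<alpha> * h i \<le> \<alpha> * ?S" by (simp add: algebra_simps)
    then show ?thesis using \<alpha> by simp
  qed
  define m where "m = Max (range h)"
  have hm: "h j \<le> m" for j by (simp add: m_def)
  have "m \<in> range h" unfolding m_def by (rule Max_in) auto
  then obtain i0 where i0: "h i0 = m" by auto
  \<comment> \<open>A single ancestor of the maximiser \<open>i0\<close> with limit 0 suffices: the
    maximum travels back along the path to \<open>k\<close>, where the upper limit is at most
    0.\<close>
  obtain k where k: "(k, i0) \<in> (trust_edges W)\<^sup>*" "d k \<longlonglongrightarrow> 0" using anc by blast
  have "h k = m"
    using k(1)
  proof (induction rule: converse_rtrancl_induct)
    case base
    show ?case by (fact i0)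
  next
    case (step j i)
    \<comment> \<open>All gaps \<open>m - h j\<close> are nonnegative, so a weighted sum that is at
      most 0 kills every gap carrying positive weight.\<close>
    have "(\<Sum>j\<in>UNIV. W $ i $ j * (m - h j)) = m - (\<Sum>j\<in>UNIV. W $ i $ j * h j)"
      using row[of i] by (simp add: right_diff_distrib sum_subtractf sum_distrib_right[symmetric])
    also have "\<dots> \<le> 0" using sub[of i] step.IH by simp
    finally have "(\<Sum>j\<in>UNIV. W $ i $ j * (m - h j)) = 0"
      using nonneg hm by (intro antisym sum_nonneg) auto
    then have "W $ i $ j * (m - h j) = 0"
      using nonneg hm by (subst (asm) sum_nonneg_eq_0_iff) auto
    then show ?case using step.hyps(1) by (auto simp: trust_edges_def)
  qed
  moreover have "h k \<le> \<epsilon>" if "\<epsilon> > 0" for \<epsilon>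
    using order_tendstoD(2)[OF k(2) that] by (intro hle) (auto elim: eventually_mono)
  ultimately have "m \<le> 0" using field_le_epsilon[of m 0] by simp
  show ?thesis
  proof (rule order_tendstoI)
    fix b :: real assume "b < 0"
    show "\<forall>\<^sub>F t in sequentially. b < d i t"
      using d by eventually_elim (use \<open>b < 0\<close> in \<open>meson less_le_trans\<close>)
  next
    fix b :: real assume "0 < b"
    then have "\<forall>\<^sub>F t in sequentially. d i t \<le> h i + b / 2" by (intro ev) simp
    then show "\<forall>\<^sub>F t in sequentially. d i t < b"
      by eventually_elim (use \<open>0 < b\<close> \<open>m \<le> 0\<close> hm[of i] in linarith)
  qed
qed

section \<open>Range and measurability of the opinions\<close>

context random_actions
begin

lemma update_nth:
  assumes "t \<ge> 1" "\<omega> \<in> space M"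
  shows "x (Suc t) \<omega> $ i = (1 - \<alpha>) * x t \<omega> $ i + \<alpha> * (\<Sum>j\<in>UNIV. W $ i $ j * a t \<omega> $ j)"
  using update[OF assms] by (simp add: matrix_vector_mult_def)

lemma weight_nonneg: "0 \<le> W $ i $ j" and weight_sum: "(\<Sum>j\<in>UNIV. W $ i $ j) = 1"
  using stochastic by (auto simp: row_stochastic_def)

text \<open>Each update is a convex combination of the old opinion and a weighted average of
  actions.\<close>

lemma opinion_range:
  assumes "t \<ge> 1" "\<omega> \<in> space M"
  shows "0 \<le> x t \<omega> $ i \<and> x t \<omega> $ i \<le> 1"
  using assms(1)
proof (induction t arbitrary: i rule: nat_induct_at_least)
  case base
  show ?case using initial_range[OF assms(2)] by simp
next
  case (Suc t)
  let ?s = "\<Sum>j\<in>UNIV. W $ i $ j * a t \<omega> $ j"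
  have a01: "0 \<le> a t \<omega> $ j \<and> a t \<omega> $ j \<le> 1" for j
    using action_range[OF Suc.hyps assms(2), of j] by auto
  have "0 \<le> ?s" using weight_nonneg a01 by (intro sum_nonneg) auto
  moreover have "?s \<le> (\<Sum>j\<in>UNIV. W $ i $ j * 1)"
    using weight_nonneg a01 by (intro sum_mono mult_left_mono) auto
  ultimately have "?s \<in> {0..1}" "x t \<omega> $ i \<in> {0..1}" using Suc.IH weight_sum by auto
  then have "(1 - \<alpha>) *\<^sub>R x t \<omega> $ i + \<alpha> *\<^sub>R ?s \<in> {0..1}"
    using alpha by (intro convexD) auto
  then show ?case using update_nth[OF Suc.hyps assms(2)] by simp
qed

lemma measurable_vec_nth [measurable]:
  "(\<lambda>\<omega>. f \<omega> $ i) \<in> borel_measurable N" if "f \<in> borel_measurable N"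
  for f :: "'w \<Rightarrow> real ^ 'n"
  using that by (rule borel_measurable_continuous_on[rotated]) (intro continuous_intros)

lemma history_generator_measurable:
  "(\<lambda>\<omega>. (x 1 \<omega>, \<lambda>s\<in>{1..<t}. a s \<omega>)) \<in> measurable M (borel \<Otimes>\<^sub>M (\<Pi>\<^sub>M s\<in>{1..<t}. borel))"
  using initial_measurable action_measurable
  by (intro measurable_Pair measurable_restrict) auto

lemma history_subalgebra: "finite_measure_subalgebra M (history M x a t)"
proof
  show "subalgebra M (history M x a t)"
    unfolding subalgebra_def history_def
    using sets_image_in_sets[OF refl history_generator_measurable] by simp
qed

lemma history_generator_measurable_history:
  "(\<lambda>\<omega>. (x 1 \<omega>, \<lambda>s\<in>{1..<t}. a s \<omega>))
     \<in> measurable (history M x a t) (borel \<Otimes>\<^sub>M (\<Pi>\<^sub>M s\<in>{1..<t}. borel))"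
  unfolding history_def
  by (rule measurable_vimage_algebra1) (auto simp: space_pair_measure space_PiM)

lemma initial_measurable_history: "x 1 \<in> borel_measurable (history M x a t)"
  using measurable_compose[OF history_generator_measurable_history measurable_fst] by simp

lemma action_measurable_history:
  assumes "1 \<le> s" "s < t"
  shows "a s \<in> borel_measurable (history M x a t)"
proof -
  have "(\<lambda>\<omega>. (\<lambda>s\<in>{1..<t}. a s \<omega>) s) \<in> borel_measurable (history M x a t)"
    using measurable_compose[OF measurable_compose[OF history_generator_measurable_history measurable_snd]
        measurable_component_singleton[of s "{1..<t}"]] assms by simp
  then show ?thesis using assms by simp
qed

lemma matrix_vector_measurable:
  "(\<lambda>\<omega>. W *v f \<omega>) \<in> borel_measurable N" if "f \<in> borel_measurable N"
  for f :: "'w \<Rightarrow> real ^ 'n"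
  using that by (rule borel_measurable_continuous_on[rotated])
    (rule matrix_vector_mult_linear_continuous_on)

text \<open>Computing \<open>x s\<close> takes only \<open>x 1\<close> and the actions before time
  \<open>s\<close>. This makes even \<open>x t\<close> known to the history at time
  \<open>t\<close>, which does not contain \<open>a t\<close>.\<close>

lemma opinion_measurable_history:
  assumes "1 \<le> s" "s \<le> t"
  shows "x s \<in> borel_measurable (history M x a t)"
  using assms
proof (induction s rule: nat_induct_at_least)
  case base
  show ?case by (rule initial_measurable_history)
next
  case (Suc s)
  have "(\<lambda>\<omega>. (1 - \<alpha>) *\<^sub>R x s \<omega> + \<alpha> *\<^sub>R (W *v a s \<omega>)) \<in> borel_measurable (history M x a t)"
    using Suc by (intro borel_measurable_add borel_measurable_scaleR borel_measurable_const
        matrix_vector_measurable action_measurable_history) auto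
  moreover have "space (history M x a t) = space M" by (simp add: history_def)
  ultimately show ?case
    using update[OF Suc.hyps] by (subst measurable_cong) auto
qed

lemma opinion_measurable [measurable]: "t \<ge> 1 \<Longrightarrow> x t \<in> borel_measurable M"
  by (rule measurable_from_subalg[OF finite_measure_subalgebra.subalg[OF history_subalgebra[of t]]])
    (rule opinion_measurable_history[OF _ order.refl])

section \<open>Expected dynamics given the history\<close>

lemma integrable_bounded:
  fixes f :: "'w \<Rightarrow> real"
  assumes "f \<in> borel_measurable M" "\<And>\<omega>. \<omega> \<in> space M \<Longrightarrow> \<bar>f \<omega>\<bar> \<le> B"
  shows "integrable M f"
  using assms by (intro integrable_const_bound[where B = B]) auto

text \<open>The action is the indicator of the event that it equals 1, and its conditional
  expectation given the history is \<open>x t \<omega> $ i\<close>. The factor \<open>Z\<close> is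
  known to the history and can be taken out of the conditional expectation.\<close>

lemma integral_action:
  assumes t: "t \<ge> 1"
    and Z: "Z \<in> borel_measurable (history M x a t)" "\<And>\<omega>. \<omega> \<in> space M \<Longrightarrow> \<bar>Z \<omega>\<bar> \<le> B"
  shows "(\<integral>\<omega>. Z \<omega> * a t \<omega> $ i \<partial>M) = (\<integral>\<omega>. Z \<omega> * x t \<omega> $ i \<partial>M)"
proof -
  interpret F: finite_measure_subalgebra M "history M x a t" by (rule history_subalgebra)
  let ?A = "{\<omega> \<in> space M. a t \<omega> $ i = 1}"
  note [measurable] = action_measurable[OF t] opinion_measurable[OF t]
  have ZM [measurable]: "Z \<in> borel_measurable M" by (rule measurable_from_subalg[OF F.subalg Z(1)])
  have A: "?A \<in> sets M" by measurable
  have int: "integrable M (\<lambda>\<omega>. Z \<omega> * indicator ?A \<omega>)"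
    using A Z(2) by (intro integrable_bounded[of _ B]) (auto split: split_indicator intro: order_trans[OF abs_ge_zero])
  have "(\<integral>\<omega>. Z \<omega> * a t \<omega> $ i \<partial>M) = (\<integral>\<omega>. Z \<omega> * indicator ?A \<omega> \<partial>M)"
    using action_range[OF t, of _ i] by (intro Bochner_Integration.integral_cong) (auto split: split_indicator)
  also have "\<dots> = (\<integral>\<omega>. Z \<omega> * real_cond_exp M (history M x a t) (indicator ?A) \<omega> \<partial>M)"
    using A by (intro F.real_cond_exp_intg(2)[symmetric] int Z(1)) auto
  also have "\<dots> = (\<integral>\<omega>. Z \<omega> * x t \<omega> $ i \<partial>M)"
    using action_bernoulli[OF t, of i] unfolding cond_prob_given_def
    by (intro integral_cong_AE) auto
  finally show ?thesis .
qed

text \<open>For \<open>z \<in> {0, 1}\<close> and \<open>u \<in> [0, 1]\<close> the distance \<open>\<bar>u - z\<bar>\<close> equals \<open>z + (1 - 2 * z) * u\<close>,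
  which is affine in \<open>u\<close> and hence propagates exactly along the expected dynamics.\<close>

lemma integral_affine_step:
  assumes t: "t \<ge> 1"
    and Z: "Z \<in> borel_measurable (history M x a t)" "\<And>\<omega>. \<omega> \<in> space M \<Longrightarrow> 0 \<le> Z \<omega> \<and> Z \<omega> \<le> 1"
  defines "f \<equiv> \<lambda>s i. \<integral>\<omega>. Z \<omega> + (1 - 2 * Z \<omega>) * x s \<omega> $ i \<partial>M"
  shows "f (Suc t) i = (1 - \<alpha>) * f t i + \<alpha> * (\<Sum>j\<in>UNIV. W $ i $ j * f t j)"
proof -
  interpret F: finite_measure_subalgebra M "history M x a t" by (rule history_subalgebra)
  note [measurable] = action_measurable[OF t] opinion_measurable[OF t]
  have ZM [measurable]: "Z \<in> borel_measurable M" by (rule measurable_from_subalg[OF F.subalg Z(1)])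
  note ZF [measurable] = Z(1)
  have intZ: "integrable M Z" using Z(2) by (intro integrable_bounded[of _ 1]) auto
  have bd: "\<bar>(1 - 2 * Z \<omega>) * u\<bar> \<le> 1" if "\<omega> \<in> space M" "0 \<le> u \<and> u \<le> 1" for \<omega> u
    unfolding abs_mult using Z(2)[OF that(1)] that(2) by (intro mult_le_one) auto
  have intx: "integrable M (\<lambda>\<omega>. (1 - 2 * Z \<omega>) * x t \<omega> $ j)" for j
    using bd opinion_range[OF t] by (intro integrable_bounded[of _ 1]) auto
  have inta: "integrable M (\<lambda>\<omega>. (1 - 2 * Z \<omega>) * a t \<omega> $ j)" for j
  proof (rule integrable_bounded[of _ 1])
    show "\<bar>(1 - 2 * Z \<omega>) * a t \<omega> $ j\<bar> \<le> 1" if "\<omega> \<in> space M" for \<omega>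
      using action_range[OF t that, of j] by (intro bd that) auto
  qed measurable
  have aff: "(\<integral>\<omega>. Z \<omega> + (1 - 2 * Z \<omega>) * a t \<omega> $ j \<partial>M) = f t j" for j
  proof -
    have "(\<integral>\<omega>. (1 - 2 * Z \<omega>) * a t \<omega> $ j \<partial>M) = (\<integral>\<omega>. (1 - 2 * Z \<omega>) * x t \<omega> $ j \<partial>M)"
    proof (rule integral_action[OF t, of _ 1])
      show "\<bar>1 - 2 * Z \<omega>\<bar> \<le> 1" if "\<omega> \<in> space M" for \<omega> using Z(2)[OF that] by auto
    qed measurable
    then show ?thesis using intZ intx inta by (simp add: f_def)
  qed
  \<comment> \<open>Affine maps commute with weighted averages: as each row of \<open>W\<close> sums
    to 1, the constant term \<open>Z \<omega>\<close> is reproduced.\<close>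
  have "Z \<omega> + (1 - 2 * Z \<omega>) * x (Suc t) \<omega> $ i =
      (1 - \<alpha>) * (Z \<omega> + (1 - 2 * Z \<omega>) * x t \<omega> $ i)
      + \<alpha> * (\<Sum>j\<in>UNIV. W $ i $ j * (Z \<omega> + (1 - 2 * Z \<omega>) * a t \<omega> $ j))"
    if "\<omega> \<in> space M" for \<omega>
  proof -
    have eq: "(\<Sum>j\<in>UNIV. W $ i $ j * (Z \<omega> + (1 - 2 * Z \<omega>) * a t \<omega> $ j))
        = (\<Sum>j\<in>UNIV. W $ i $ j) * Z \<omega> + (1 - 2 * Z \<omega>) * (\<Sum>j\<in>UNIV. W $ i $ j * a t \<omega> $ j)"
      by (simp add: distrib_left sum.distrib sum_distrib_left sum_distrib_right mult_ac)
    show ?thesis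
      unfolding eq update_nth[OF t that] weight_sum by (simp add: algebra_simps)
  qed
  then have "f (Suc t) i = (\<integral>\<omega>. (1 - \<alpha>) * (Z \<omega> + (1 - 2 * Z \<omega>) * x t \<omega> $ i)
      + \<alpha> * (\<Sum>j\<in>UNIV. W $ i $ j * (Z \<omega> + (1 - 2 * Z \<omega>) * a t \<omega> $ j)) \<partial>M)"
    unfolding f_def by (intro Bochner_Integration.integral_cong) auto
  also have "\<dots> = (1 - \<alpha>) * f t i
      + \<alpha> * (\<Sum>j\<in>UNIV. W $ i $ j * (\<integral>\<omega>. Z \<omega> + (1 - 2 * Z \<omega>) * a t \<omega> $ j \<partial>M))"
  proof -
    have ia: "integrable M (\<lambda>\<omega>. W $ i $ j * (Z \<omega> + (1 - 2 * Z \<omega>) * a t \<omega> $ j))" for j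
      by (intro integrable_mult_right Bochner_Integration.integrable_add intZ inta)
    have ix: "integrable M (\<lambda>\<omega>. Z \<omega> + (1 - 2 * Z \<omega>) * x t \<omega> $ i)"
      by (intro Bochner_Integration.integrable_add intZ intx)
    show ?thesis
      by (subst Bochner_Integration.integral_add)
        (use ia ix in \<open>auto simp: f_def Bochner_Integration.integral_sum
           intro!: integrable_mult_right Bochner_Integration.integrable_sum
           simp del: Bochner_Integration.integral_add\<close>)
  qed
  finally show ?thesis by (simp add: aff)
qed

text \<open>At each time the limit \<open>c\<close> is replaced by the current opinion of agent \<open>k\<close>, which is known
  to the history.\<close>

lemma distance_step:
  assumes t: "t \<ge> 1"
    and c [measurable]: "c \<in> borel_measurable M" and c01: "\<And>\<omega>. c \<omega> \<in> {0, 1}"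
  defines "d \<equiv> \<lambda>i t. \<integral>\<omega>. \<bar>x t \<omega> $ i - c \<omega>\<bar> \<partial>M"
  shows "d i (Suc t) \<le> (1 - \<alpha>) * d i t + \<alpha> * (\<Sum>j\<in>UNIV. W $ i $ j * d j t) + 2 * d k t"
proof -
  define Z where "Z \<omega> = x t \<omega> $ k" for \<omega>
  define f where "f s i = (\<integral>\<omega>. Z \<omega> + (1 - 2 * Z \<omega>) * x s \<omega> $ i \<partial>M)" for s i
  have ZF: "Z \<in> borel_measurable (history M x a t)"
    unfolding Z_def using opinion_measurable_history[OF t order.refl] by measurable
  have Z01: "0 \<le> Z \<omega> \<and> Z \<omega> \<le> 1" if "\<omega> \<in> space M" for \<omega>
    using opinion_range[OF t that] by (simp add: Z_def)
  have [measurable]: "Z \<in> borel_measurable M" unfolding Z_def using opinion_measurable[OF t] by measurable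
  \<comment> \<open>\<open>c\<close> need not be known to the history, so \<open>Z\<close> stands in
    for it. With \<open>c\<close> in place of \<open>Z\<close> the affine expression would be the
    distance itself; the replacement costs
    \<open>(1 - 2 * x s \<omega> $ j) * (Z \<omega> - c \<omega>)\<close>, whose first factor has
    modulus at most 1. The bound is the same for every time \<open>s\<close>.\<close>
  have close: "\<bar>f s j - d j s\<bar> \<le> d k t" if s: "s \<ge> 1" for s j
  proof -
    note [measurable] = opinion_measurable[OF s]
    have pt: "\<bar>Z \<omega> + (1 - 2 * Z \<omega>) * x s \<omega> $ j - \<bar>x s \<omega> $ j - c \<omega>\<bar>\<bar> \<le> \<bar>Z \<omega> - c \<omega>\<bar>"
      if \<omega>: "\<omega> \<in> space M" for \<omega>
    proof -
      have u: "0 \<le> x s \<omega> $ j" "x s \<omega> $ j \<le> 1" using opinion_range[OF s \<omega>] by auto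
      have "Z \<omega> + (1 - 2 * Z \<omega>) * x s \<omega> $ j - \<bar>x s \<omega> $ j - c \<omega>\<bar>
          = (1 - 2 * x s \<omega> $ j) * (Z \<omega> - c \<omega>)"
        using c01[of \<omega>] u by (auto simp: algebra_simps)
      moreover have "\<bar>(1 - 2 * x s \<omega> $ j) * (Z \<omega> - c \<omega>)\<bar> \<le> 1 * \<bar>Z \<omega> - c \<omega>\<bar>"
        unfolding abs_mult using u by (intro mult_right_mono) auto
      ultimately show ?thesis by simp
    qed
    have i1: "integrable M (\<lambda>\<omega>. Z \<omega> + (1 - 2 * Z \<omega>) * x s \<omega> $ j)"
    proof (rule integrable_bounded[of _ 2])
      show "\<bar>Z \<omega> + (1 - 2 * Z \<omega>) * x s \<omega> $ j\<bar> \<le> 2" if "\<omega> \<in> space M" for \<omega>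
        using pt[OF that] opinion_range[OF s that, of j] Z01[OF that] c01[of \<omega>] by auto
    qed measurable
    have i2: "integrable M (\<lambda>\<omega>. \<bar>x s \<omega> $ j - c \<omega>\<bar>)"
    proof (rule integrable_bounded[of _ 1])
      show "\<bar>\<bar>x s \<omega> $ j - c \<omega>\<bar>\<bar> \<le> 1" if "\<omega> \<in> space M" for \<omega>
        using opinion_range[OF s that, of j] c01[of \<omega>] by auto
    qed measurable
    have i3: "integrable M (\<lambda>\<omega>. \<bar>Z \<omega> - c \<omega>\<bar>)"
    proof (rule integrable_bounded[of _ 1])
      show "\<bar>\<bar>Z \<omega> - c \<omega>\<bar>\<bar> \<le> 1" if "\<omega> \<in> space M" for \<omega>
        using Z01[OF that] c01[of \<omega>] by auto
    qed measurable
    have "\<bar>f s j - d j s\<bar> = \<bar>\<integral>\<omega>. Z \<omega> + (1 - 2 * Z \<omega>) * x s \<omega> $ j - \<bar>x s \<omega> $ j - c \<omega>\<bar> \<partial>M\<bar>"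
      unfolding f_def d_def by (subst Bochner_Integration.integral_diff[OF i1 i2]) simp
    also have "\<dots> \<le> (\<integral>\<omega>. \<bar>Z \<omega> + (1 - 2 * Z \<omega>) * x s \<omega> $ j - \<bar>x s \<omega> $ j - c \<omega>\<bar>\<bar> \<partial>M)"
      by (rule integral_abs_bound)
    also have "\<dots> \<le> (\<integral>\<omega>. \<bar>Z \<omega> - c \<omega>\<bar> \<partial>M)"
      by (rule integral_mono[OF integrable_abs[OF Bochner_Integration.integrable_diff[OF i1 i2]] i3 pt])
    finally show ?thesis by (simp add: d_def Z_def)
  qed
  have "f (Suc t) i = (1 - \<alpha>) * f t i + \<alpha> * (\<Sum>j\<in>UNIV. W $ i $ j * f t j)"
    unfolding f_def by (rule integral_affine_step[OF t ZF Z01])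
  moreover have "(\<Sum>j\<in>UNIV. W $ i $ j * f t j) \<le> (\<Sum>j\<in>UNIV. W $ i $ j * d j t) + d k t"
  proof -
    have "(\<Sum>j\<in>UNIV. W $ i $ j * f t j) \<le> (\<Sum>j\<in>UNIV. W $ i $ j * (d j t + d k t))"
    proof (intro sum_mono mult_left_mono weight_nonneg)
      show "f t j \<le> d j t + d k t" for j using close[OF t, of j] by linarith
    qed
    also have "\<dots> = (\<Sum>j\<in>UNIV. W $ i $ j * d j t) + d k t"
      using weight_sum[of i] by (simp add: distrib_left sum.distrib sum_distrib_right[symmetric])
    finally show ?thesis .
  qed
  then have "\<alpha> * (\<Sum>j\<in>UNIV. W $ i $ j * f t j) \<le> \<alpha> * ((\<Sum>j\<in>UNIV. W $ i $ j * d j t) + d k t)"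
    using alpha by (intro mult_left_mono) auto
  moreover have "f t i \<le> d i t + d k t" using close[OF t, of i] by linarith
  then have "(1 - \<alpha>) * f t i \<le> (1 - \<alpha>) * (d i t + d k t)"
    using alpha by (intro mult_left_mono) auto
  moreover have "d i (Suc t) \<le> f (Suc t) i + d k t" using close[of "Suc t" i] by simp
  \<comment> \<open>The replacement is made once at time \<open>t\<close> and once at time
    \<open>Suc t\<close>, whence the factor 2.\<close>
  ultimately show ?thesis by (simp add: algebra_simps)
qed

section \<open>From mean convergence to all moments\<close>

text \<open>The Euclidean norm is at most the sum \<open>S\<close> of the coordinate distances,
  which never exceeds the number of agents. On this bounded range the affine bound for powers
  reduces the moment to coordinatewise means.\<close>

lemma converges_in_moment_of_L1:
  assumes y [measurable]: "y \<in> borel_measurable M"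
    and y01: "\<And>\<omega>. \<omega> \<in> space M \<Longrightarrow> y \<omega> \<in> {vec 0, vec 1}"
    and L1: "\<And>i. (\<lambda>t. \<integral>\<omega>. \<bar>x t \<omega> $ i - y \<omega> $ i\<bar> \<partial>M) \<longlonglongrightarrow> 0"
    and r: "r > 0"
  shows "converges_in_moment M x y r"
proof -
  let ?K = "real CARD('n)"
  define S where "S t \<omega> = (\<Sum>i\<in>UNIV. \<bar>x t \<omega> $ i - y \<omega> $ i\<bar>)" for t \<omega>
  have le1: "\<bar>x t \<omega> $ i - y \<omega> $ i\<bar> \<le> 1" if "t \<ge> 1" "\<omega> \<in> space M" for t \<omega> i
    using opinion_range[OF that, of i] y01[OF that(2)] by auto
  have normS: "norm (x t \<omega> - y \<omega>) \<le> S t \<omega>" for t \<omega>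
    using norm_le_l1_cart[of "x t \<omega> - y \<omega>"] by (simp add: S_def)
  have SK: "S t \<omega> \<le> ?K" if "t \<ge> 1" "\<omega> \<in> space M" for t \<omega>
    unfolding S_def using sum_mono[of UNIV "\<lambda>i. \<bar>x t \<omega> $ i - y \<omega> $ i\<bar>" "\<lambda>_. 1"] le1[OF that] by simp
  have inti: "integrable M (\<lambda>\<omega>. \<bar>x t \<omega> $ i - y \<omega> $ i\<bar>)" if t: "t \<ge> 1" for t i
    using le1[OF t] opinion_measurable[OF t] by (intro integrable_bounded[of _ 1]) auto
  have int: "integrable M (\<lambda>\<omega>. norm (x t \<omega> - y \<omega>) powr r)" if t: "t \<ge> 1" for t
  proof (rule integrable_bounded[of _ "?K powr r"])
    show "\<bar>norm (x t \<omega> - y \<omega>) powr r\<bar> \<le> ?K powr r" if "\<omega> \<in> space M" for \<omega>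
      using order_trans[OF normS SK[OF t that]] r by (auto intro!: powr_mono2)
  qed (use opinion_measurable[OF t] in measurable)
  have "(\<lambda>t. \<integral>\<omega>. norm (x t \<omega> - y \<omega>) powr r \<partial>M) \<longlonglongrightarrow> 0"
  proof (rule order_tendstoI)
    fix b :: real assume "b < 0"
    then show "\<forall>\<^sub>F t in sequentially. b < (\<integral>\<omega>. norm (x t \<omega> - y \<omega>) powr r \<partial>M)"
      by (intro always_eventually allI) (rule less_le_trans, auto)
  next
    fix b :: real assume "0 < b"
    \<comment> \<open>Half of \<open>b\<close> pays for the constant term. The other half pays for
      the linear term, which tends to 0 because \<open>C\<close> does not depend on
      \<open>t\<close>.\<close>
    then obtain C where C: "C \<ge> 0" "\<And>u. 0 \<le> u \<Longrightarrow> u \<le> ?K \<Longrightarrow> u powr r \<le> b / 2 + C * u"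
      using powr_le_affine[OF r, of "b / 2" ?K] by auto
    have "(\<lambda>t. C * (\<Sum>i\<in>UNIV. \<integral>\<omega>. \<bar>x t \<omega> $ i - y \<omega> $ i\<bar> \<partial>M)) \<longlonglongrightarrow> C * (\<Sum>i\<in>(UNIV::'n set). 0)"
      by (intro tendsto_intros L1)
    then have "\<forall>\<^sub>F t in sequentially. C * (\<Sum>i\<in>UNIV. \<integral>\<omega>. \<bar>x t \<omega> $ i - y \<omega> $ i\<bar> \<partial>M) < b / 2"
      using \<open>0 < b\<close> by (intro order_tendstoD) auto
    then show "\<forall>\<^sub>F t in sequentially. (\<integral>\<omega>. norm (x t \<omega> - y \<omega>) powr r \<partial>M) < b"
      using eventually_ge_at_top[of 1]
    proof eventually_elim
      case (elim t)
      have intS: "integrable M (S t)"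
        unfolding S_def using inti[OF elim(2)] by (intro Bochner_Integration.integrable_sum)
      have "(\<integral>\<omega>. norm (x t \<omega> - y \<omega>) powr r \<partial>M) \<le> (\<integral>\<omega>. b / 2 + C * S t \<omega> \<partial>M)"
      proof (intro integral_mono int elim)
        show "integrable M (\<lambda>\<omega>. b / 2 + C * S t \<omega>)" using intS by simp
        fix \<omega> assume \<omega>: "\<omega> \<in> space M"
        have "norm (x t \<omega> - y \<omega>) powr r \<le> b / 2 + C * norm (x t \<omega> - y \<omega>)"
          using order_trans[OF normS SK[OF elim(2) \<omega>]] by (intro C) auto
        also have "\<dots> \<le> b / 2 + C * S t \<omega>"
          using normS C by (intro add_left_mono mult_left_mono)
        finally show "norm (x t \<omega> - y \<omega>) powr r \<le> b / 2 + C * S t \<omega>" .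
      qed
      also have "\<dots> = b / 2 + C * (\<integral>\<omega>. S t \<omega> \<partial>M)"
        using intS by (simp add: prob_space)
      also have "(\<integral>\<omega>. S t \<omega> \<partial>M) = (\<Sum>i\<in>UNIV. \<integral>\<omega>. \<bar>x t \<omega> $ i - y \<omega> $ i\<bar> \<partial>M)"
        unfolding S_def using inti[OF elim(2)] by (intro Bochner_Integration.integral_sum)
      finally show ?case using elim(1) by linarith
    qed
  qed
  with int show ?thesis by (auto simp: converges_in_moment_def)
qed

section \<open>Consensus inherited from the maximal components\<close>

text \<open>The limit is read off one agent \<open>k\<close> of a maximal component, which turns a
  value chosen separately for each \<open>\<omega>\<close> into a random variable. Dominated
  convergence gives mean convergence on maximal components, and the averaging inequality carries it
  to all agents.\<close>

lemma consensus_of_maximal_consensus: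
  assumes conv: "AE \<omega> in M. \<exists>c\<in>{0, 1}. \<forall>C\<in>maximal_components W. \<forall>i\<in>C. (\<lambda>t. x t \<omega> $ i) \<longlonglongrightarrow> c"
  shows "consensus_in_all_moments M x"
proof -
  obtain C k where k: "C \<in> maximal_components W" "k \<in> C"
    using maximal_ancestor[of W] by metis
  \<comment> \<open>The test against 1 keeps \<open>c\<close> in {0, 1} even where the opinions of
    \<open>k\<close> fail to converge. The index is shifted because measurability is available from
    time 1 on.\<close>
  define c :: "'w \<Rightarrow> real" where
    "c \<omega> = (if lim (\<lambda>t. x (Suc t) \<omega> $ k) = 1 then 1 else 0)" for \<omega>
  define y :: "'w \<Rightarrow> real ^ 'n" where
    "y \<omega> = (if lim (\<lambda>t. x (Suc t) \<omega> $ k) = 1 then vec 1 else vec 0)" for \<omega>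
  have lim [measurable]: "(\<lambda>\<omega>. lim (\<lambda>t. x (Suc t) \<omega> $ k)) \<in> borel_measurable M"
    using opinion_measurable by (intro borel_measurable_lim_metric measurable_vec_nth) simp
  have c [measurable]: "c \<in> borel_measurable M" unfolding c_def by measurable
  have y: "y \<in> borel_measurable M" unfolding y_def by measurable
  have c01: "c \<omega> \<in> {0, 1}" for \<omega> by (simp add: c_def)
  have y_nth: "y \<omega> $ i = c \<omega>" for \<omega> i by (simp add: y_def c_def)
  define d where "d i t = (\<integral>\<omega>. \<bar>x t \<omega> $ i - c \<omega>\<bar> \<partial>M)" for i t
  have conv_c: "AE \<omega> in M. \<forall>D\<in>maximal_components W. \<forall>i\<in>D. (\<lambda>t. x t \<omega> $ i) \<longlonglongrightarrow> c \<omega>"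
    using conv
  proof eventually_elim
    case (elim \<omega>)
    then obtain c' where c': "c' \<in> {0, 1}"
      "\<forall>D\<in>maximal_components W. \<forall>i\<in>D. (\<lambda>t. x t \<omega> $ i) \<longlonglongrightarrow> c'" by blast
    then have "lim (\<lambda>t. x (Suc t) \<omega> $ k) = c'"
      using k by (intro limI LIMSEQ_Suc) blast
    then have "c \<omega> = c'" using c'(1) by (auto simp: c_def)
    then show ?case using c'(2) by simp
  qed
  have le1: "\<bar>x t \<omega> $ i - c \<omega>\<bar> \<le> 1" if "t \<ge> 1" "\<omega> \<in> space M" for t \<omega> i
    using opinion_range[OF that, of i] c01[of \<omega>] by auto
  have d_max: "d i \<longlonglongrightarrow> 0" if i: "D \<in> maximal_components W" "i \<in> D" for D i
  proof -
    have "(\<lambda>t. \<integral>\<omega>. \<bar>x (Suc t) \<omega> $ i - c \<omega>\<bar> \<partial>M) \<longlonglongrightarrow> (\<integral>\<omega>. 0 \<partial>M)"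
    proof (rule integral_dominated_convergence[where w = "\<lambda>_. 1"])
      show "AE \<omega> in M. (\<lambda>t. \<bar>x (Suc t) \<omega> $ i - c \<omega>\<bar>) \<longlonglongrightarrow> 0"
        using conv_c
      proof eventually_elim
        case (elim \<omega>)
        then have "(\<lambda>t. x (Suc t) \<omega> $ i) \<longlonglongrightarrow> c \<omega>" using i by (intro LIMSEQ_Suc) blast
        then show ?case by (intro tendsto_rabs_zero LIM_zero)
      qed
      show "(\<lambda>\<omega>. \<bar>x (Suc t) \<omega> $ i - c \<omega>\<bar>) \<in> borel_measurable M" for t
        using opinion_measurable[of "Suc t"] by measurable
      show "AE \<omega> in M. norm \<bar>x (Suc t) \<omega> $ i - c \<omega>\<bar> \<le> 1" for t
        using le1 by (intro AE_I2) simp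
    qed auto
    then have "(\<lambda>t. d i (Suc t)) \<longlonglongrightarrow> 0" by (simp add: d_def)
    then show ?thesis by (rule LIMSEQ_imp_Suc)
  qed
  have "d i \<longlonglongrightarrow> 0" for i
  proof (rule tendsto_zero_of_ancestors[OF stochastic alpha])
    show "\<forall>\<^sub>F t in sequentially. \<forall>i. 0 \<le> d i t \<and> d i t \<le> 1"
      using eventually_ge_at_top[of 1]
    proof eventually_elim
      case (elim t)
      have "d i t \<le> (\<integral>\<omega>. 1 \<partial>M)" for i
        unfolding d_def
      proof (rule integral_mono)
        show "integrable M (\<lambda>\<omega>. \<bar>x t \<omega> $ i - c \<omega>\<bar>)"
          using le1[OF elim] opinion_measurable[OF elim] by (intro integrable_bounded[of _ 1]) auto
      qed (use le1[OF elim] in auto)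
      then show ?case by (auto simp: d_def prob_space)
    qed
    show "\<forall>\<^sub>F t in sequentially. \<forall>i.
        d i (Suc t) \<le> (1 - \<alpha>) * d i t + \<alpha> * (\<Sum>j\<in>UNIV. W $ i $ j * d j t) + 2 * d k t"
      using eventually_ge_at_top[of 1]
      by eventually_elim (use distance_step[OF _ c c01] in \<open>auto simp: d_def\<close>)
    show "(\<lambda>t. 2 * d k t) \<longlonglongrightarrow> 0" using tendsto_mult_right_zero[OF d_max[OF k], of 2] by simp
    show "\<exists>k. (k, i) \<in> (trust_edges W)\<^sup>* \<and> d k \<longlonglongrightarrow> 0" for i
      using maximal_ancestor[of W i] d_max by metis
  qed
  then have "converges_in_moment M x y r" if "r > 0" for r
    using that y by (intro converges_in_moment_of_L1) (auto simp: y_nth d_def[abs_def], auto simp: y_def)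
  with y show ?thesis
    unfolding consensus_in_all_moments_def by (intro bexI[of _ y]) (auto simp: y_def)
qed

section \<open>Stubborn agents\<close>

text \<open>When the opinion is 0 or 1, \<open>?g\<close> is the distance between action and
  opinion. Its integral does not change when the action is replaced by the opinion, which makes the
  integrand vanish almost surely; a nonnegative function with integral 0 is 0 almost
  everywhere.\<close>

lemma action_eq_opinion:
  assumes t: "t \<ge> 1" and x01: "AE \<omega> in M. x t \<omega> $ k \<in> {0, 1}"
  shows "AE \<omega> in M. a t \<omega> $ k = x t \<omega> $ k"
proof -
  note [measurable] = action_measurable[OF t] opinion_measurable[OF t]
  define Z where "Z \<omega> = 1 - 2 * x t \<omega> $ k" for \<omega>
  have ZF: "Z \<in> borel_measurable (history M x a t)"
    unfolding Z_def using opinion_measurable_history[OF t order.refl] by measurable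
  have [measurable]: "Z \<in> borel_measurable M" unfolding Z_def by measurable
  have Z1: "\<bar>Z \<omega>\<bar> \<le> 1" if "\<omega> \<in> space M" for \<omega>
    using opinion_range[OF t that, of k] by (auto simp: Z_def)
  let ?g = "\<lambda>\<omega>. x t \<omega> $ k + Z \<omega> * a t \<omega> $ k"
  have ix: "integrable M (\<lambda>\<omega>. x t \<omega> $ k)"
    using opinion_range[OF t, of _ k] by (intro integrable_bounded[of _ 1]) auto
  have iZ: "integrable M (\<lambda>\<omega>. Z \<omega> * b \<omega> $ k)"
    if "b \<in> borel_measurable M" "\<And>\<omega>. \<omega> \<in> space M \<Longrightarrow> 0 \<le> b \<omega> $ k \<and> b \<omega> $ k \<le> 1"
    for b :: "'w \<Rightarrow> real ^ 'n"
    using that Z1 by (intro integrable_bounded[of _ 1]) (auto simp: abs_mult intro!: mult_le_one)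
  have a01: "0 \<le> a t \<omega> $ k \<and> a t \<omega> $ k \<le> 1" if "\<omega> \<in> space M" for \<omega>
    using action_range[OF t that, of k] by auto
  have iZa: "integrable M (\<lambda>\<omega>. Z \<omega> * a t \<omega> $ k)" by (rule iZ) (simp_all add: a01)
  have iZx: "integrable M (\<lambda>\<omega>. Z \<omega> * x t \<omega> $ k)" by (rule iZ) (simp_all add: opinion_range[OF t])
  have "(\<integral>\<omega>. ?g \<omega> \<partial>M) = (\<integral>\<omega>. x t \<omega> $ k + Z \<omega> * x t \<omega> $ k \<partial>M)"
    using ix iZa iZx integral_action[OF t ZF Z1, of k] by simp
  also have "\<dots> = (\<integral>\<omega>. 0 \<partial>M)"
  proof (rule integral_cong_AE)
    show "AE \<omega> in M. x t \<omega> $ k + Z \<omega> * x t \<omega> $ k = 0"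
      using x01 by eventually_elim (auto simp: Z_def)
  qed measurable
  finally have 0: "(\<integral>\<omega>. ?g \<omega> \<partial>M) = 0" by simp
  have nonneg: "AE \<omega> in M. 0 \<le> ?g \<omega>"
    using x01 AE_space by eventually_elim (auto simp: Z_def dest: a01)
  have "integrable M ?g" using ix iZa by simp
  then have "AE \<omega> in M. ?g \<omega> = 0"
    using 0 integral_nonneg_eq_0_iff_AE[OF _ nonneg] by simp
  then show ?thesis
    using x01 by eventually_elim (auto simp: Z_def)
qed

text \<open>Agent \<open>k\<close> listens only to its own action, and at an extreme opinion this
  action repeats the opinion.\<close>

lemma stubborn_opinion_constant:
  assumes max: "maximal_components W = {{k}}" and x01: "AE \<omega> in M. x 1 \<omega> $ k \<in> {0, 1}"
    and t: "t \<ge> 1"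
  shows "AE \<omega> in M. x t \<omega> $ k = x 1 \<omega> $ k"
  using t
proof (induction t rule: nat_induct_at_least)
  case base
  show ?case by simp
next
  case (Suc t)
  have Wk: "(\<Sum>j\<in>UNIV. W $ k $ j * a t \<omega> $ j) = a t \<omega> $ k" for \<omega>
    unfolding singleton_maximal_component_weight[OF stochastic max]
    by (simp add: if_distrib[of "\<lambda>w. w * _"] cong: if_cong)
  have "AE \<omega> in M. x t \<omega> $ k \<in> {0, 1}"
    using Suc.IH x01 by eventually_elim simp
  then have "AE \<omega> in M. a t \<omega> $ k = x t \<omega> $ k" by (rule action_eq_opinion[OF Suc.hyps])
  then show ?case
    using Suc.IH AE_space
    by eventually_elim (simp add: update_nth[OF Suc.hyps] Wk algebra_simps)
qed

lemma consensus_of_stubborn: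
  assumes max: "maximal_components W = {{k}}" and x01: "AE \<omega> in M. x 1 \<omega> $ k \<in> {0, 1}"
  shows "consensus_in_all_moments M x"
proof (rule consensus_of_maximal_consensus)
  \<comment> \<open>The exceptional null sets of the countably many times are merged, so that almost
    every path of \<open>k\<close> is constant from time 1 and converges to its own initial
    value.\<close>
  have "AE \<omega> in M. \<forall>t\<in>{1..}. x t \<omega> $ k = x 1 \<omega> $ k"
    using stubborn_opinion_constant[OF max x01] by (subst AE_ball_countable) auto
  then show "AE \<omega> in M. \<exists>c\<in>{0, 1}. \<forall>C\<in>maximal_components W. \<forall>i\<in>C. (\<lambda>t. x t \<omega> $ i) \<longlonglongrightarrow> c"
    using x01
  proof eventually_elim
    case (elim \<omega>)
    have "\<forall>\<^sub>F t in sequentially. x t \<omega> $ k = x 1 \<omega> $ k"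
      by (rule eventually_mono[OF eventually_ge_at_top[of 1]]) (use elim(1) in blast)
    then have "(\<lambda>t. x t \<omega> $ k) \<longlonglongrightarrow> x 1 \<omega> $ k" by (rule tendsto_eventually)
    then show ?case using elim(2) max by auto
  qed
qed

end

theorem corollary2:
  fixes M :: "'w measure"
    and \<alpha> :: real
    and W :: "real ^ 'n::finite ^ 'n"
    and x a :: "nat \<Rightarrow> 'w \<Rightarrow> real ^ 'n"
  assumes "random_actions M \<alpha> W x a"
  shows "((AE \<omega> in M. \<exists>c\<in>{0, 1}. \<forall>C\<in>maximal_components W. \<forall>i\<in>C.
            (\<lambda>t. x t \<omega> $ i) \<longlonglongrightarrow> c)
          \<longrightarrow> consensus_in_all_moments M x) \<and>
         (\<forall>k. maximal_components W = {{k}} \<and> (AE \<omega> in M. x 1 \<omega> $ k \<in> {0, 1})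
          \<longrightarrow> consensus_in_all_moments M x)"
proof -
  interpret random_actions M \<alpha> W x a by fact
  show ?thesis
    using consensus_of_maximal_consensus consensus_of_stubborn by blast
qed

end
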